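(* There is an absolute constant $C>0$ such that the following holds. Let $(X,\mu)$ be a $\sigma$-finite measure space and let $s(\cdot)\in \mathcal{P}(X,\mu)$ be such that $1< s(\cdot)<\infty$ almost everywhere. Let $\mathcal{B}$ be a countable collection of measurable sets such that $0<\mu(B)<\infty$ for every $B\in\mathcal{B}$. For each $B\in\mathcal B$ let $E(B)\subset B$ be a measurable subset with $0<\mu(E(B))<\infty$, the sets $E(B)$, $B\in\mathcal B$, being pairwise disjoint, and let $a_B\geq 0$. Then $$\left\| \left\{ a_B\, \mu(E(B))^{1/s^\mu_{E(B)}} \right\}_{B\in\mathcal{B}}\right\|_{\ell^{s^\mu_{E(B)}}(\mathcal B)} \le C\, \Bigl\| \sum_{B\in\mathcal{B}}a_B1_{E(B)} \Bigr\|_{L^{s(\cdot)}(X,\mu)}.$$ Moreover, the reverse bound holds in the following form: $$\Bigl\| \sum_{B\in\mathcal{B}}a_B1_{E(B)} \Bigr\|_{L^{s(\cdot)}(X,\mu)} \le C\, \|M_{\mathcal{B}}\|_{L^{s'(\cdot)}(X,\mu)\to L^{s'(\cdot)}(X,\mu)}\left\| \left\{ \frac{\mu(B)}{\mu(E(B))}\, a_B\, \mu(E(B))^{1/s^{\mu}_{E(B)}} \right\}_{B\in\mathcal B}\right\|_{\ell^{s^{\mu}_{E(B)}}(\mathcal{B})}.$$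
   Context: $\mathcal{P}(X,\mu)$ is the set of measurable functions $p(\cdot):X\to[1,\infty]$. The norm of $L^{p(\cdot)}(X,\mu)$ is $\|f\|_{L^{p(\cdot)}}=\inf\{\lambda>0:\rho_{p(\cdot)}(f/\lambda)\le1\}$, where $\rho_{p(\cdot)}(f)=\int_{\{p(\cdot)<\infty\}}|f(x)|^{p(x)}\,d\mu(x)+\|f\|_{L^\infty(\{p(\cdot)=\infty\})}$. The conjugate exponent is given by $\frac1{s(\cdot)}+\frac1{s'(\cdot)}=1$, with $1/\infty=0$. For a measurable set $E$ with $0<\mu(E)<\infty$, the harmonic mean $s^\mu_E$ is given by $\frac1{s_E^\mu}=\frac1{\mu(E)}\int_E\frac{1}{s(x)}\,d\mu(x)$. The space $\ell^{s^\mu_{E(B)}}(\mathcal B)$ is the variable exponent Lebesgue space $L^{t(\cdot)}$ over the index set $\mathcal B$ with counting measure and with exponent $t(B)=s^\mu_{E(B)}$. The maximal operator is $M_{\mathcal B}h(x)=\sup_{B\in\mathcal B}\frac{1_B(x)}{\mu(B)}\int_B|h|\,d\mu$, and $\|M_{\mathcal B}\|_{Z\to Z}$ is the smallest $C\in[0,\infty]$ with $\|M_{\mathcal B}h\|_Z\le C\|h\|_Z$ for all $h\in Z$. *)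

theory Defs
  imports "HOL-Analysis.Analysis" "HOL-Probability.Essential_Supremum"
begin

text \<open>
  Exponents are extended-valued, so that \<open>inverse \<infinity> = 0\<close> and \<open>inverse 0 = \<infinity>\<close> hold.
  Norms only depend on the absolute value of a function; they are therefore defined on
  \<open>[0, \<infinity>]\<close>-valued functions, which also covers maximal functions. A real-valued function \<open>h\<close>
  enters as \<open>\<lambda>x. ennreal \<bar>h x\<bar>\<close>.
\<close>

definition var_exponents :: "'a measure \<Rightarrow> ('a \<Rightarrow> ennreal) set" where
  "var_exponents M = {p \<in> borel_measurable M. \<forall>x\<in>space M. 1 \<le> p x}"

definition conj_exponent :: "('a \<Rightarrow> ennreal) \<Rightarrow> 'a \<Rightarrow> ennreal" where
  "conj_exponent p x = inverse (1 - inverse (p x))"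

text \<open>The power \<open>t\<^sup>r\<close> with \<open>\<infinity>\<^sup>r = \<infinity>\<close>; only used for \<open>r > 0\<close>.\<close>

definition enn_power :: "ennreal \<Rightarrow> real \<Rightarrow> ennreal" where
  "enn_power t r = (if t = \<infinity> then \<infinity> else ennreal (enn2real t powr r))"

definition var_modular :: "'a measure \<Rightarrow> ('a \<Rightarrow> ennreal) \<Rightarrow> ('a \<Rightarrow> ennreal) \<Rightarrow> ennreal" where
  "var_modular M p F =
     (\<integral>\<^sup>+x\<in>{x\<in>space M. p x < \<infinity>}. enn_power (F x) (enn2real (p x)) \<partial>M)
     + esssup (restrict_space M {x\<in>space M. p x = \<infinity>}) F"

definition var_norm :: "'a measure \<Rightarrow> ('a \<Rightarrow> ennreal) \<Rightarrow> ('a \<Rightarrow> ennreal) \<Rightarrow> ennreal" where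
  "var_norm M p F =
     Inf {ennreal l | l. 0 < l \<and> var_modular M p (\<lambda>x. F x / ennreal l) \<le> 1}"

definition var_Lebesgue :: "'a measure \<Rightarrow> ('a \<Rightarrow> ennreal) \<Rightarrow> ('a \<Rightarrow> real) set" where
  "var_Lebesgue M p = {h \<in> borel_measurable M. var_norm M p (\<lambda>x. ennreal \<bar>h x\<bar>) < \<infinity>}"

definition harmonic_mean :: "'a measure \<Rightarrow> ('a \<Rightarrow> ennreal) \<Rightarrow> 'a set \<Rightarrow> ennreal" where
  "harmonic_mean M s E = inverse ((\<integral>\<^sup>+x\<in>E. inverse (s x) \<partial>M) / emeasure M E)"

definition maximal_op :: "'a measure \<Rightarrow> 'a set set \<Rightarrow> ('a \<Rightarrow> real) \<Rightarrow> 'a \<Rightarrow> ennreal" where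
  "maximal_op M \<B> h x =
     (SUP B\<in>\<B>. indicator B x / emeasure M B * (\<integral>\<^sup>+y\<in>B. ennreal \<bar>h y\<bar> \<partial>M))"

definition maximal_op_norm :: "'a measure \<Rightarrow> 'a set set \<Rightarrow> ('a \<Rightarrow> ennreal) \<Rightarrow> ennreal" where
  "maximal_op_norm M \<B> p =
     Inf {C. \<forall>h\<in>var_Lebesgue M p.
            var_norm M p (maximal_op M \<B> h) \<le> C * var_norm M p (\<lambda>x. ennreal \<bar>h x\<bar>)}"

lemma conj_exponent:
  assumes "1 \<le> p x"
  shows "inverse (p x) + inverse (conj_exponent p x) = 1"
proof -
  have "inverse (p x) \<le> 1"
    using assms by (metis divide_ennreal_def divide_le_posI_ennreal mult_1 mult.right_neutral order_less_le_trans zero_less_one)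
  moreover have "inverse (inverse t) = t" for t :: ennreal
  proof (cases "t = 0 \<or> t = top")
    case False
    then show ?thesis
      by (cases t) (auto simp: inverse_ennreal)
  qed auto
  ultimately show ?thesis
    by (simp add: conj_exponent_def add_diff_inverse_ennreal)
qed

lemma maximal_op_norm_bound:
  assumes fin: "maximal_op_norm M \<B> p < \<infinity>" and h: "h \<in> var_Lebesgue M p"
  shows "var_norm M p (maximal_op M \<B> h)
    \<le> maximal_op_norm M \<B> p * var_norm M p (\<lambda>x. ennreal \<bar>h x\<bar>)"
proof -
  let ?S = "{C. \<forall>h\<in>var_Lebesgue M p.
            var_norm M p (maximal_op M \<B> h) \<le> C * var_norm M p (\<lambda>x. ennreal \<bar>h x\<bar>)}"
  define n where "n = var_norm M p (\<lambda>x. ennreal \<bar>h x\<bar>)"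
  define m where "m = var_norm M p (maximal_op M \<B> h)"
  have n: "n < \<infinity>"
    using h by (simp add: var_Lebesgue_def n_def)
  have S: "m \<le> C * n" if "C \<in> ?S" for C
    using that h by (auto simp: m_def n_def)
  have "m \<le> Inf ?S * n"
  proof (cases "n = 0")
    case True
    have "?S \<noteq> {}"
      using fin by (auto simp only: maximal_op_norm_def Inf_empty infinity_ennreal_def less_irrefl)
    then obtain C where "C \<in> ?S" by blast
    from S[OF this] True show ?thesis by simp
  next
    case False
    have "m / n \<le> Inf ?S"
    proof (rule Inf_greatest)
      fix C assume "C \<in> ?S"
      from S[OF this] False n show "m / n \<le> C"
        by (metis divide_le_posI_ennreal not_gr_zero mult.commute)
    qed
    then have "m / n * n \<le> Inf ?S * n"
      by (rule mult_right_mono) simp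
    moreover have "m / n * n = m"
      using n False by (simp add: ennreal_divide_times mult_divide_eq_ennreal)
    ultimately show ?thesis by simp
  qed
  then show ?thesis
    by (simp add: m_def n_def maximal_op_norm_def)
qed

text \<open>
  A constant that is existentially quantified in a theorem about all measure spaces over a type
  \<open>'a\<close> may depend on that type. To make the constant of the main statement absolute, i.e. the same
  for all types, the statement bounds it by a numeral, \<open>C \<le> 100\<close>. The numeral has no other
  significance and is not meant to be optimal.
\<close>

end

theory Submission
  imports Defs "HOL-Probability.Probability_Measure"
begin

text \<open>
  Everything rests on one inequality. Let \<open>t\<close> be the harmonic mean of \<open>s\<close> over \<open>E\<close>, so that \<open>1/t\<close> is the
  mean of \<open>1/s\<close>. The map \<open>u \<mapsto> a\<^bsup>1/u\<^esup>\<close> is convex on \<open>(0,1)\<close> when \<open>a \<ge> 1\<close> and also when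
  \<open>a \<le> e\<^bsup>-2\<^esup>\<close>, and then Jensen's inequality for \<open>u = 1/s\<close> says that \<open>a\<^sup>t\<close> is at most the mean of
  \<open>a\<^sup>s\<close> over \<open>E\<close>. The gap \<open>e\<^bsup>-2\<^esup> < a < 1\<close> is crossed by giving up a factor \<open>8 \<ge> e\<^sup>2\<close> in the base:
  for every \<open>a\<close>, \<open>(a/8)\<^sup>t \<mu>(E) \<le> \<integral>\<^sub>E a\<^sup>s d\<mu>\<close> (\<open>enn_power_harmonic_mean_le\<close>). Summing over disjoint sets
  \<open>E i\<close> bounds the sequence \<open>\<alpha> i \<mu>(E i)\<^bsup>1/t i\<^esup>\<close> by \<open>8\<close> times the norm of any function that is at least
  \<open>\<alpha> i\<close> on each \<open>E i\<close> (\<open>var_norm_harmonic_means_le\<close>). The first bound of the theorem is this for the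
  function \<open>f = \<Sum>\<^sub>B a B 1\<^bsub>E B\<^esub>\<close>.

  The second bound follows by duality from the same estimate. If \<open>\<kappa> < \<parallel>f\<parallel>\<close> in \<open>L\<^sup>s\<close>, there is \<open>g \<ge> 0\<close> of norm
  at most \<open>1\<close> in \<open>L\<^bsup>s'\<^esup>\<close> with \<open>\<integral> f g = \<kappa>\<close> (\<open>var_norm_dual_witness\<close>). Let \<open>\<alpha> B\<close> be the mean of \<open>g\<close> over \<open>B\<close>.
  Since \<open>E B \<subseteq> B\<close>,
  \<open>\<kappa> = \<Sum>\<^sub>B a B \<integral>\<^bsub>E B\<^esub> g \<le> \<Sum>\<^sub>B a B \<mu>(B) \<alpha> B = \<Sum>\<^sub>B c B d B\<close>, where
  \<open>c B = \<mu>(B)/\<mu>(E B) a B \<mu>(E B)\<^bsup>1/t B\<^esup>\<close> is the sequence of the theorem and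
  \<open>d B = \<alpha> B \<mu>(E B)\<^bsup>1/t' B\<^esup>\<close>. The conjugate \<open>t'\<close> of the harmonic mean is the harmonic mean of the
  conjugate \<open>s'\<close>, and the maximal function of \<open>g\<close> is at least \<open>\<alpha> B\<close> on \<open>E B\<close>, so the sequence estimate
  for the exponent \<open>s'\<close> bounds the norm of \<open>d\<close> by \<open>8\<close> times the norm of the maximal operator. Hoelder's
  inequality with constant \<open>2\<close> (\<open>var_Hoelder\<close>) gives the theorem with \<open>C = 16\<close>.
\<close>

section \<open>Powers of constants and harmonic means of exponents\<close>

lemma enn_power_ennreal: "0 \<le> a \<Longrightarrow> enn_power (ennreal a) r = ennreal (a powr r)"
  by (simp add: enn_power_def)

lemma enn_power_top [simp]: "enn_power top r = top"
  by (simp add: enn_power_def)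

lemma enn_power_0 [simp]: "enn_power 0 r = 0"
  by (simp add: enn_power_def)

lemma enn_power_eq_0_iff [simp]: "enn_power t r = 0 \<longleftrightarrow> t = 0"
  by (cases t) (auto simp: enn_power_def ennreal_eq_0_iff)

lemma enn_power_mono:
  assumes "t \<le> u" "0 \<le> r"
  shows "enn_power t r \<le> enn_power u r"
  using assms by (cases t; cases u) (auto simp: enn_power_def top_unique intro!: ennreal_leI powr_mono2)

lemma enn_power_mult:
  assumes "0 < a"
  shows "enn_power (ennreal a * t) r = ennreal (a powr r) * enn_power t r"
proof (cases t)
  case (real u)
  then show ?thesis
    using assms by (simp add: enn_power_ennreal powr_mult flip: ennreal_mult)
next
  case top
  then show ?thesis
    using assms by (simp add: ennreal_mult_top ennreal_eq_0_iff)
qed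

lemma enn_power_measurable [measurable]:
  assumes [measurable]: "F \<in> borel_measurable M" "r \<in> borel_measurable M"
  shows "(\<lambda>x. enn_power (F x) (r x)) \<in> borel_measurable M"
  unfolding enn_power_def by measurable

text \<open>
  This is the map \<open>u \<mapsto> a\<^bsup>1/u\<^esup>\<close> with \<open>a = exp (- c)\<close>. Its second derivative has the sign of \<open>c (c - 2 u)\<close>,
  which changes inside the interval for \<open>0 < c < 2\<close>.
\<close>

lemma convex_on_exp_neg_inverse:
  fixes c :: real
  assumes c: "c \<le> 0 \<or> 2 \<le> c"
  shows "convex_on {0<..<1} (\<lambda>u. exp (- c / u))"
proof (rule f''_ge0_imp_convex)
  fix u :: real
  assume u: "u \<in> {0<..<1}"
  show "((\<lambda>u. exp (- c / u)) has_real_derivative exp (- c / u) * (c / u\<^sup>2)) (at u)"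
    using u by (auto intro!: derivative_eq_intros simp: field_simps power2_eq_square)
  show "((\<lambda>u. exp (- c / u) * (c / u\<^sup>2)) has_real_derivative
      exp (- c / u) * (c * (c - 2 * u) / u ^ 4)) (at u)"
    using u by (auto intro!: derivative_eq_intros simp: field_simps power2_eq_square power4_eq_xxxx)
  have "0 \<le> c * (c - 2 * u)"
    using c u by (auto intro: mult_nonneg_nonneg mult_nonpos_nonpos)
  then show "0 \<le> exp (- c / u) * (c * (c - 2 * u) / u ^ 4)"
    by simp
qed simp

lemma (in prob_space) exp_neg_inverse_expectation_le:
  fixes X :: "'a \<Rightarrow> real"
  assumes X: "integrable M X" "AE x in M. X x \<in> {0<..<1}"
    and c: "c \<le> 0 \<or> 2 \<le> c"
  shows "ennreal (exp (- c / expectation X)) \<le> (\<integral>\<^sup>+x. ennreal (exp (- c / X x)) \<partial>M)"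
proof (cases "integrable M (\<lambda>x. exp (- c / X x))")
  case True
  have "exp (- c / expectation X) \<le> expectation (\<lambda>x. exp (- c / X x))"
    using X True convex_on_exp_neg_inverse[OF c] by (intro jensens_inequality) auto
  with True show ?thesis
    by (simp add: nn_integral_eq_integral)
next
  case False
  moreover have "(\<lambda>x. exp (- c / X x)) \<in> borel_measurable M"
    using borel_measurable_integrable[OF X(1)] by measurable
  ultimately show ?thesis
    by (simp add: nn_integral_nonneg_infinite)
qed

text \<open>
  Jensen's inequality for the random variable \<open>1/s\<close> under the uniform distribution on \<open>E\<close>; its mean \<open>v\<close> is
  the reciprocal of the harmonic mean. The base of the powers is \<open>exp (- c)\<close>.
\<close>

lemma harmonic_mean_Jensen:
  assumes E: "E \<in> sets M" "0 < emeasure M E" "emeasure M E < \<infinity>"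
    and s [measurable]: "s \<in> borel_measurable M"
    and s1: "AE x in M. 1 < s x \<and> s x < \<infinity>"
  obtains v where "0 < v" "v < 1" "harmonic_mean M s E = ennreal (1 / v)"
    "(\<integral>\<^sup>+x\<in>E. inverse (s x) \<partial>M) = ennreal v * emeasure M E"
    "\<And>c. c \<le> 0 \<or> 2 \<le> c \<Longrightarrow> ennreal (exp (- c / v)) * emeasure M E
       \<le> (\<integral>\<^sup>+x\<in>E. ennreal (exp (- c * enn2real (s x))) \<partial>M)"
proof -
  note [measurable] = E(1)
  define N where "N = uniform_measure M E"
  have N_integral: "(\<integral>\<^sup>+x. f x \<partial>N) * emeasure M E = (\<integral>\<^sup>+x\<in>E. f x \<partial>M)"
    if "f \<in> borel_measurable M" for f
    unfolding N_def using E that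
    by (simp add: nn_integral_uniform_measure ennreal_divide_times mult_divide_eq_ennreal)
  interpret N: prob_space N
    unfolding N_def using E by (intro prob_space_uniform_measure) auto
  define X where "X x = enn2real (inverse (s x))" for x
  have AE_N: "AE x in N. 1 < s x \<and> s x < \<infinity>"
    unfolding N_def using s1 by (intro AE_uniform_measureI) auto
  have [measurable]: "X \<in> borel_measurable N" "s \<in> borel_measurable N"
    unfolding X_def N_def by measurable
  have X01: "AE x in N. X x \<in> {0<..<1} \<and> inverse (s x) = ennreal (X x) \<and> enn2real (s x) = 1 / X x"
    using AE_N
  proof eventually_elim
    case (elim x)
    then obtain r where r: "s x = ennreal r" "0 \<le> r"
      by (cases "s x") auto
    with elim have "1 < r"
      by (simp add: ennreal_less_iff flip: ennreal_1)
    with r show ?case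
      by (simp add: X_def inverse_ennreal field_simps)
  qed
  have X_int: "integrable N X"
    by (rule N.integrable_const_bound[where B = 1]) (use X01 in auto)
  define v where "v = N.expectation X"
  have v: "0 < v" "v < 1"
    unfolding v_def using X01 X_int by (auto intro!: N.expectation_greater N.expectation_less)
  have "(\<integral>\<^sup>+x. inverse (s x) \<partial>N) = (\<integral>\<^sup>+x. ennreal (X x) \<partial>N)"
    using X01 by (intro nn_integral_cong_AE) auto
  also have "\<dots> = ennreal v"
    unfolding v_def using X_int X01 by (intro nn_integral_eq_integral) auto
  finally have inv: "(\<integral>\<^sup>+x. inverse (s x) \<partial>N) = ennreal v" .
  then have mean: "(\<integral>\<^sup>+x\<in>E. inverse (s x) \<partial>M) = ennreal v * emeasure M E"
    using N_integral[of "\<lambda>x. inverse (s x)"] by simp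
  have "harmonic_mean M s E = inverse (ennreal v)"
    unfolding harmonic_mean_def mean using E by (simp add: mult_divide_eq_ennreal)
  then have hm: "harmonic_mean M s E = ennreal (1 / v)"
    using v by (simp add: inverse_ennreal inverse_eq_divide)
  have Jensen: "ennreal (exp (- c / v)) * emeasure M E
       \<le> (\<integral>\<^sup>+x\<in>E. ennreal (exp (- c * enn2real (s x))) \<partial>M)" if c: "c \<le> 0 \<or> 2 \<le> c" for c
  proof -
    have "ennreal (exp (- c / v)) \<le> (\<integral>\<^sup>+x. ennreal (exp (- c / X x)) \<partial>N)"
      unfolding v_def using X_int X01 c by (intro N.exp_neg_inverse_expectation_le) auto
    also have "\<dots> = (\<integral>\<^sup>+x. ennreal (exp (- c * enn2real (s x))) \<partial>N)"
      by (rule nn_integral_cong_AE, rule eventually_mono[OF X01]) auto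
    finally have "ennreal (exp (- c / v)) * emeasure M E
        \<le> (\<integral>\<^sup>+x. ennreal (exp (- c * enn2real (s x))) \<partial>N) * emeasure M E"
      by (rule mult_right_mono) simp
    then show ?thesis
      by (subst (asm) N_integral) auto
  qed
  show thesis
    using v hm mean Jensen by (rule that)
qed

text \<open>
  If \<open>\<alpha> \<ge> 8\<close> or \<open>\<alpha> \<le> 1\<close>, then the base \<open>\<alpha>/8\<close> is at least \<open>1\<close> or at most \<open>1/8 \<le> e\<^bsup>-2\<^esup>\<close>, and Jensen's
  inequality applies to it. If \<open>1 < \<alpha> < 8\<close>, the base \<open>1\<close> separates the two sides.
\<close>

lemma enn_power_harmonic_mean_le:
  assumes E: "E \<in> sets M" "0 < emeasure M E" "emeasure M E < \<infinity>"
    and s [measurable]: "s \<in> borel_measurable M"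
    and s1: "AE x in M. 1 < s x \<and> s x < \<infinity>"
  shows "enn_power (\<alpha> / 8) (enn2real (harmonic_mean M s E)) * emeasure M E
    \<le> (\<integral>\<^sup>+x\<in>E. enn_power \<alpha> (enn2real (s x)) \<partial>M)"
proof -
  consider "\<alpha> = 0" | "\<alpha> = top" | a where "\<alpha> = ennreal a" "0 < a"
    by (cases \<alpha>) (auto simp: less_le)
  then show ?thesis
  proof cases
    case 1
    then show ?thesis
      by simp
  next
    case 2
    then show ?thesis
      using E by (simp add: nn_integral_cmult_indicator ennreal_top_mult_right)
  next
    case (3 a)
    obtain v where v: "0 < v" "v < 1" "harmonic_mean M s E = ennreal (1 / v)"
      and Jensen: "\<And>c. c \<le> 0 \<or> 2 \<le> c \<Longrightarrow> ennreal (exp (- c / v)) * emeasure M E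
         \<le> (\<integral>\<^sup>+x\<in>E. ennreal (exp (- c * enn2real (s x))) \<partial>M)"
      using harmonic_mean_Jensen[OF E s s1] by metis
    have e2: "exp 2 \<le> (8 :: real)"
    proof -
      have "exp 2 = exp 1 * exp (1 :: real)"
        by (simp flip: exp_add)
      also have "\<dots> \<le> 272 / 100 * (272 / 100)"
        using e_less_272 by (intro mult_mono) auto
      finally show ?thesis by simp
    qed
    (* exp (- c) is the base, between \<alpha> / 8 and \<alpha>, for which Jensen's inequality holds. *)
    obtain c where c: "c \<le> 0 \<or> 2 \<le> c" "a / 8 \<le> exp (- c)" "exp (- c) \<le> a"
    proof (cases "1 < a \<and> a < 8")
      case True
      then show thesis by (intro that[of 0]) auto
    next
      case False
      have "2 \<le> ln (8 :: real)" 
        using e2 by (simp add: ln_ge_iff)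
      with False 3 have "- ln (a / 8) \<le> 0 \<or> 2 \<le> - ln (a / 8)"
        by (auto simp: not_less ln_div intro: order_trans[of _ "ln 8"])
      with 3 show thesis
        by (intro that[of "- ln (a / 8)"]) auto
    qed
    have "enn_power (\<alpha> / 8) (enn2real (harmonic_mean M s E)) = ennreal ((a / 8) powr (1 / v))"
      using 3 v by (simp add: ennreal_divide_numeral enn_power_ennreal)
    also have "\<dots> \<le> ennreal (exp (- c) powr (1 / v))"
      using 3 c v by (intro ennreal_leI powr_mono2) auto
    also have "exp (- c) powr (1 / v) = exp (- c / v)"
      by (simp add: exp_powr_real)
    finally have "enn_power (\<alpha> / 8) (enn2real (harmonic_mean M s E)) * emeasure M E
        \<le> ennreal (exp (- c / v)) * emeasure M E"
      by (rule mult_right_mono) simp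
    also have "\<dots> \<le> (\<integral>\<^sup>+x\<in>E. ennreal (exp (- c * enn2real (s x))) \<partial>M)"
      using c by (intro Jensen)
    also have "\<dots> \<le> (\<integral>\<^sup>+x\<in>E. enn_power \<alpha> (enn2real (s x)) \<partial>M)"
    proof (intro nn_integral_mono mult_right_mono)
      fix x
      have "exp (- c * enn2real (s x)) = exp (- c) powr enn2real (s x)"
        by (simp add: exp_powr_real)
      also have "\<dots> \<le> a powr enn2real (s x)"
        using c by (intro powr_mono2) auto
      finally show "ennreal (exp (- c * enn2real (s x))) \<le> enn_power \<alpha> (enn2real (s x))"
        using 3 by (simp add: enn_power_ennreal ennreal_leI)
    qed auto
    finally show ?thesis .
  qed
qed

section \<open>Variable exponent norms and Hoelder's inequality\<close>

lemma inverse_inverse_ennreal [simp]: "inverse (inverse t) = (t :: ennreal)"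
proof (cases "t = 0 \<or> t = top")
  case False
  then show ?thesis
    by (cases t) (auto simp: inverse_ennreal)
qed auto

lemma ennreal_mult_divide_cancel:
  fixes c x :: ennreal
  shows "c \<noteq> 0 \<Longrightarrow> c \<noteq> top \<Longrightarrow> c * (x / c) = x"
  by (metis ennreal_times_divide mult.commute mult_divide_eq_ennreal)

text \<open>
  The set where the exponent is infinite is null, and the essential supremum over a null set is \<open>0\<close>.
\<close>

lemma var_modular_eq_nn_integral:
  assumes [measurable]: "p \<in> borel_measurable M" "F \<in> borel_measurable M"
    and fin: "AE x in M. p x < \<infinity>"
  shows "var_modular M p F = (\<integral>\<^sup>+x. enn_power (F x) (enn2real (p x)) \<partial>M)"
proof -
  define N where "N = restrict_space M {x\<in>space M. p x = \<infinity>}"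
  have "AE x in N. F x \<le> 0"
    unfolding N_def using fin by (subst AE_restrict_space_iff) auto
  moreover have "F \<in> borel_measurable N"
    unfolding N_def by (simp add: measurable_restrict_space1)
  ultimately have "esssup N F = 0"
    using esssup_eq_AE[of F N] by (auto intro!: antisym Inf_lower)
  moreover have "(\<integral>\<^sup>+x\<in>{x\<in>space M. p x < \<infinity>}. enn_power (F x) (enn2real (p x)) \<partial>M)
      = (\<integral>\<^sup>+x. enn_power (F x) (enn2real (p x)) \<partial>M)"
  proof (rule nn_integral_cong_AE)
    show "AE x in M. enn_power (F x) (enn2real (p x)) * indicator {x \<in> space M. p x < \<infinity>} x
        = enn_power (F x) (enn2real (p x))"
      using fin AE_space by eventually_elim simp
  qed
  ultimately show ?thesis
    by (simp add: var_modular_def N_def)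
qed

lemma var_norm_le:
  assumes "0 < l" "var_modular M p (\<lambda>x. F x / ennreal l) \<le> 1"
  shows "var_norm M p F \<le> ennreal l"
  unfolding var_norm_def using assms by (intro Inf_lower) auto

lemma var_norm_cong_exponent:
  assumes "\<And>x. x \<in> space M \<Longrightarrow> p x = q x"
  shows "var_norm M p F = var_norm M q F"
proof -
  have "{x \<in> space M. p x < \<infinity>} = {x \<in> space M. q x < \<infinity>}"
    "{x \<in> space M. p x = \<infinity>} = {x \<in> space M. q x = \<infinity>}"
    using assms by auto
  then have "var_modular M p G = var_modular M q G" for G
    unfolding var_modular_def using assms
    by (auto intro!: arg_cong2[where f = "(+)"] nn_integral_cong)
  then show ?thesis
    by (simp add: var_norm_def)
qed

lemma var_norm_le_cmult:
  assumes c: "0 < c"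
    and le: "\<And>l. 0 < l \<Longrightarrow> var_modular M p (\<lambda>x. F x / ennreal l) \<le> 1 \<Longrightarrow>
               var_modular N q (\<lambda>x. G x / ennreal (c * l)) \<le> 1"
  shows "var_norm N q G \<le> ennreal c * var_norm M p F"
proof -
  have "var_norm N q G / ennreal c \<le> var_norm M p F"
    unfolding var_norm_def[of M p F]
  proof (rule Inf_greatest, clarify)
    fix l :: real
    assume l: "0 < l" "var_modular M p (\<lambda>x. F x / ennreal l) \<le> 1"
    have "var_norm N q G \<le> ennreal (c * l)"
      using c l le by (intro var_norm_le) auto
    also have "\<dots> = ennreal c * ennreal l"
      using c l by (simp add: ennreal_mult)
    finally show "var_norm N q G / ennreal c \<le> ennreal l"
      using c by (intro divide_le_posI_ennreal) (auto simp: mult.commute)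
  qed
  then have "ennreal c * (var_norm N q G / ennreal c) \<le> ennreal c * var_norm M p F"
    by (rule mult_left_mono) simp
  moreover have "ennreal c * (var_norm N q G / ennreal c) = var_norm N q G"
    using c by (simp add: ennreal_mult_divide_cancel ennreal_eq_0_iff)
  ultimately show ?thesis
    by simp
qed

text \<open>
  For \<open>l \<le> 1\<close> and \<open>p \<ge> 1\<close> one has \<open>F\<^sup>p \<le> l (F/l)\<^sup>p\<close>, so a function of norm less than \<open>l\<close> has modular at
  most \<open>l\<close>. This makes Hoelder's inequality true also when one norm is \<open>0\<close> and the other is \<open>\<infinity>\<close>.
\<close>

lemma AE_eq_0_if_var_norm_eq_0:
  assumes [measurable]: "p \<in> borel_measurable M" "F \<in> borel_measurable M"
    and p: "AE x in M. 1 \<le> p x \<and> p x < \<infinity>"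
    and 0: "var_norm M p F = 0"
  shows "AE x in M. F x = 0"
proof -
  let ?I = "\<integral>\<^sup>+x. enn_power (F x) (enn2real (p x)) \<partial>M"
  have fin: "AE x in M. p x < \<infinity>"
    using p by auto
  have bound: "?I \<le> ennreal e" if e: "0 < e" "e < 1" for e
  proof -
    have "var_norm M p F < ennreal e"
      using 0 e by simp
    then obtain l where l: "0 < l" "l < e" "var_modular M p (\<lambda>x. F x / ennreal l) \<le> 1"
      unfolding var_norm_def Inf_less_iff by (auto simp: ennreal_less_iff)
    have "?I \<le> (\<integral>\<^sup>+x. ennreal l * enn_power (F x / ennreal l) (enn2real (p x)) \<partial>M)"
      using p
    proof (intro nn_integral_mono_AE, eventually_elim)
      case (elim x)
      then have r: "1 \<le> enn2real (p x)"
        by (cases "p x") auto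
      have "enn_power (F x) (enn2real (p x))
          = enn_power (ennreal l * (F x / ennreal l)) (enn2real (p x))"
        using l by (simp add: ennreal_mult_divide_cancel ennreal_eq_0_iff)
      also have "\<dots> = ennreal (l powr enn2real (p x)) * enn_power (F x / ennreal l) (enn2real (p x))"
        using l by (simp add: enn_power_mult)
      also have "\<dots> \<le> ennreal (l powr 1) * enn_power (F x / ennreal l) (enn2real (p x))"
        using l e r by (intro mult_right_mono ennreal_leI powr_mono') auto
      finally show ?case
        using l by simp
    qed
    also have "\<dots> = ennreal l * var_modular M p (\<lambda>x. F x / ennreal l)"
      using fin by (simp add: var_modular_eq_nn_integral nn_integral_cmult)
    also have "\<dots> \<le> ennreal l * 1"
      using l by (intro mult_left_mono) auto
    also have "\<dots> \<le> ennreal e"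
      using l by (simp add: ennreal_leI)
    finally show ?thesis .
  qed
  have "?I = 0"
  proof (rule ccontr)
    assume "?I \<noteq> 0"
    moreover have "?I < top"
      using le_less_trans[OF bound[of "1/2"] ennreal_less_top] by simp
    ultimately obtain r where r: "?I = ennreal r" "0 < r"
      by (cases ?I) (auto simp: less_le)
    define e where "e = min r 1 / 2"
    have e: "0 < e" "e < 1" "e < r"
      using r by (auto simp: e_def min_def)
    show False
      using bound[OF e(1,2)] e r by simp
  qed
  then show ?thesis
    by (subst (asm) nn_integral_0_iff_AE) auto
qed

lemma one_less_conj_exponent_finite:
  assumes "1 < p x" "p x < \<infinity>"
  obtains r where "1 < r" "p x = ennreal r" "conj_exponent p x = ennreal (r / (r - 1))"
proof -
  from assms obtain r where r: "p x = ennreal r" "0 \<le> r"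
    by (cases "p x") auto
  with assms have "1 < r"
    by (simp add: ennreal_less_iff flip: ennreal_1)
  then have "1 - inverse (p x) = ennreal (1 - inverse r)" "0 < 1 - inverse r"
    using r by (simp_all add: inverse_ennreal ennreal_minus field_simps flip: ennreal_1)
  then have "conj_exponent p x = ennreal (inverse (1 - inverse r))"
    by (simp add: conj_exponent_def inverse_ennreal)
  with \<open>1 < r\<close> r show thesis
    by (intro that[of r]) (auto simp: field_simps)
qed

lemma one_less_conj_exponent:
  assumes "1 < p x" "p x < \<infinity>"
  shows "1 < conj_exponent p x" "conj_exponent p x < top"
proof -
  obtain r where "1 < r" "conj_exponent p x = ennreal (r / (r - 1))"
    using assms by (rule one_less_conj_exponent_finite)
  then show "1 < conj_exponent p x" "conj_exponent p x < top"
    by (auto simp: ennreal_less_iff field_simps simp flip: ennreal_1)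
qed

lemma conj_exponent_in_var_exponents:
  assumes "p \<in> var_exponents M"
  shows "conj_exponent p \<in> var_exponents M"
proof -
  have [measurable]: "p \<in> borel_measurable M"
    using assms by (simp add: var_exponents_def)
  have "1 \<le> conj_exponent p x" for x
  proof -
    have "1 - inverse (p x) \<le> 1"
      by (simp add: diff_le_self_ennreal)
    then show ?thesis
      unfolding conj_exponent_def
      by (cases "1 - inverse (p x)"; cases "1 - inverse (p x) = 0")
         (auto simp: inverse_ennreal field_simps less_le simp flip: ennreal_1 intro!: ennreal_leI)
  qed
  moreover have "conj_exponent p \<in> borel_measurable M"
    unfolding conj_exponent_def[abs_def] by measurable
  ultimately show ?thesis
    by (simp add: var_exponents_def)
qed

text \<open>
  Young's inequality with its weights \<open>1/p\<close> and \<open>1/p'\<close> replaced by \<open>1\<close>, so that the right-hand side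
  integrates to a sum of two modulars.
\<close>

lemma mult_le_enn_power_conj_exponent:
  assumes "1 < p x" "p x < \<infinity>"
  shows "a * b \<le> enn_power a (enn2real (p x)) + enn_power b (enn2real (conj_exponent p x))"
proof (cases "a = top \<or> b = top")
  case False
  then obtain a' b' where ab: "a = ennreal a'" "0 \<le> a'" "b = ennreal b'" "0 \<le> b'"
    by (cases a; cases b) auto
  obtain r where r: "1 < r" "p x = ennreal r" "conj_exponent p x = ennreal (r / (r - 1))"
    using assms by (rule one_less_conj_exponent_finite)
  define q where "q = r / (r - 1)"
  have q: "1 < q" "1 / r + 1 / q = 1"
    using r by (auto simp: q_def field_simps)
  have "a' * b' \<le> a' powr r / r + b' powr q / q"
    using r q ab by (intro Youngs_inequality) auto
  also have "\<dots> \<le> a' powr r / 1 + b' powr q / 1"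
    using r q by (intro add_mono divide_left_mono) auto
  finally have "ennreal (a' * b') \<le> ennreal (a' powr r + b' powr q)"
    by (intro ennreal_leI) simp
  then show ?thesis
    using r q ab by (simp add: enn_power_ennreal q_def[symmetric] ennreal_mult)
qed auto

text \<open>
  Young's inequality is integrated for \<open>F/l\<close> and \<open>G/m\<close> with \<open>l\<close> and \<open>m\<close> admissible in the definitions of
  the two norms; then the infimum is taken over \<open>m\<close> and over \<open>l\<close>.
\<close>

lemma var_Hoelder:
  assumes [measurable]: "p \<in> borel_measurable M" "F \<in> borel_measurable M" "G \<in> borel_measurable M"
    and p: "AE x in M. 1 < p x \<and> p x < \<infinity>"
  shows "(\<integral>\<^sup>+x. F x * G x \<partial>M) \<le> 2 * (var_norm M p F * var_norm M (conj_exponent p) G)"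
proof -
  define q where "q = conj_exponent p"
  have [measurable]: "q \<in> borel_measurable M"
    unfolding q_def conj_exponent_def[abs_def] by measurable
  have one: "AE x in M. 1 \<le> p x \<and> p x < \<infinity>" "AE x in M. 1 \<le> q x \<and> q x < \<infinity>"
    by (rule eventually_mono[OF p]; simp add: q_def one_less_conj_exponent less_imp_le)+
  then have fin: "AE x in M. p x < \<infinity>" "AE x in M. q x < \<infinity>"
    by auto
  let ?I = "\<integral>\<^sup>+x. F x * G x \<partial>M"
  have unit: "?I \<le> ennreal l * (ennreal m * 2)"
    if l: "0 < l" "var_modular M p (\<lambda>x. F x / ennreal l) \<le> 1"
      and m: "0 < m" "var_modular M q (\<lambda>x. G x / ennreal m) \<le> 1" for l m
  proof -
    have "?I = (\<integral>\<^sup>+x. (ennreal l * ennreal m) * ((F x / ennreal l) * (G x / ennreal m)) \<partial>M)"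
    proof (rule nn_integral_cong)
      fix x
      have "F x = ennreal l * (F x / ennreal l)" "G x = ennreal m * (G x / ennreal m)"
        using l m by (simp_all add: ennreal_mult_divide_cancel ennreal_eq_0_iff)
      then show "F x * G x = (ennreal l * ennreal m) * ((F x / ennreal l) * (G x / ennreal m))"
        by (metis mult.assoc mult.left_commute)
    qed
    also have "\<dots> = (ennreal l * ennreal m) * (\<integral>\<^sup>+x. (F x / ennreal l) * (G x / ennreal m) \<partial>M)"
      by (simp add: nn_integral_cmult)
    also have "(\<integral>\<^sup>+x. (F x / ennreal l) * (G x / ennreal m) \<partial>M)
        \<le> (\<integral>\<^sup>+x. enn_power (F x / ennreal l) (enn2real (p x))
               + enn_power (G x / ennreal m) (enn2real (q x)) \<partial>M)"
      unfolding q_def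
      by (rule nn_integral_mono_AE, rule eventually_mono[OF p]) (simp add: mult_le_enn_power_conj_exponent)
    also have "\<dots> = var_modular M p (\<lambda>x. F x / ennreal l) + var_modular M q (\<lambda>x. G x / ennreal m)"
      using fin by (simp add: var_modular_eq_nn_integral nn_integral_add)
    also have "\<dots> \<le> 1 + 1"
      using l m by (intro add_mono) auto
    finally show ?thesis
      by (simp add: mult_left_mono mult.assoc)
  qed
  have half: "?I \<le> ennreal l * (2 * var_norm M q G)"
    if l: "0 < l" "var_modular M p (\<lambda>x. F x / ennreal l) \<le> 1" for l
  proof -
    have "?I / (ennreal l * 2) \<le> var_norm M q G"
      unfolding var_norm_def
    proof (rule Inf_greatest, clarify)
      fix m :: real
      assume "0 < m" "var_modular M q (\<lambda>x. G x / ennreal m) \<le> 1"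
      from unit[OF l this] l show "?I / (ennreal l * 2) \<le> ennreal m"
        by (intro divide_le_posI_ennreal) (auto simp: ac_simps ennreal_zero_less_mult_iff)
    qed
    then have "(ennreal l * 2) * (?I / (ennreal l * 2)) \<le> (ennreal l * 2) * var_norm M q G"
      by (rule mult_left_mono) simp
    moreover have "(ennreal l * 2) * (?I / (ennreal l * 2)) = ?I"
      using l by (simp add: ennreal_mult_divide_cancel ennreal_eq_0_iff ennreal_mult_eq_top_iff)
    ultimately show ?thesis
      by (simp add: ac_simps)
  qed
  show ?thesis
  proof (cases "var_norm M p F = 0 \<or> var_norm M q G = 0")
    case True
    then have "AE x in M. F x = 0 \<or> G x = 0"
      using AE_eq_0_if_var_norm_eq_0[OF _ _ one(1), of F] AE_eq_0_if_var_norm_eq_0[OF _ _ one(2), of G]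
      by auto
    then have "?I = 0"
      by (subst nn_integral_0_iff_AE) auto
    then show ?thesis
      by simp
  next
    case False
    show ?thesis
    proof (cases "var_norm M q G = top")
      case True
      with False show ?thesis
        by (simp add: q_def[symmetric] ennreal_mult_top)
    next
      case fin: False
      have "?I / (2 * var_norm M q G) \<le> var_norm M p F"
        unfolding var_norm_def[of M p F]
      proof (rule Inf_greatest, clarify)
        fix l :: real
        assume "0 < l" "var_modular M p (\<lambda>x. F x / ennreal l) \<le> 1"
        from half[OF this] False show "?I / (2 * var_norm M q G) \<le> ennreal l"
          by (intro divide_le_posI_ennreal) (auto simp: ac_simps ennreal_zero_less_mult_iff zero_less_iff_neq_zero)
      qed
      then have "(2 * var_norm M q G) * (?I / (2 * var_norm M q G)) \<le> (2 * var_norm M q G) * var_norm M p F"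
        by (rule mult_left_mono) simp
      moreover have "(2 * var_norm M q G) * (?I / (2 * var_norm M q G)) = ?I"
        using False fin
        by (simp add: ennreal_mult_divide_cancel ennreal_mult_eq_top_iff)
      ultimately show ?thesis
        by (simp add: ac_simps q_def)
    qed
  qed
qed

section \<open>Harmonic means of conjugate exponents\<close>

lemma harmonic_mean_bounds:
  assumes "E \<in> sets M" "0 < emeasure M E" "emeasure M E < \<infinity>" "s \<in> borel_measurable M"
    and "AE x in M. 1 < s x \<and> s x < \<infinity>"
  shows "1 < harmonic_mean M s E" "harmonic_mean M s E < \<infinity>"
proof -
  obtain v where "0 < v" "v < 1" "harmonic_mean M s E = ennreal (1 / v)"
    using harmonic_mean_Jensen[OF assms] by metis
  then show "1 < harmonic_mean M s E" "harmonic_mean M s E < \<infinity>"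
    by (auto simp: ennreal_less_iff simp flip: ennreal_1)
qed

text \<open>
  Since \<open>1/s + 1/s' = 1\<close> pointwise, the means of \<open>1/s\<close> and of \<open>1/s'\<close> over \<open>E\<close> add up to \<open>1\<close>.
\<close>

lemma harmonic_mean_conj_exponent:
  assumes E: "E \<in> sets M" "0 < emeasure M E" "emeasure M E < \<infinity>"
    and s: "s \<in> var_exponents M"
    and s1: "AE x in M. 1 < s x \<and> s x < \<infinity>"
  obtains v where "0 < v" "v < 1" "inverse (harmonic_mean M s E) = ennreal v"
    "inverse (harmonic_mean M (conj_exponent s) E) = ennreal (1 - v)"
proof -
  have s' [measurable]: "s \<in> borel_measurable M" "conj_exponent s \<in> borel_measurable M"
    using s conj_exponent_in_var_exponents[OF s] by (auto simp: var_exponents_def)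
  note [measurable] = E(1)
  have s1': "AE x in M. 1 < conj_exponent s x \<and> conj_exponent s x < \<infinity>"
    by (rule eventually_mono[OF s1]) (simp add: one_less_conj_exponent)
  obtain v where v: "0 < v" "v < 1" "harmonic_mean M s E = ennreal (1 / v)"
      "(\<integral>\<^sup>+x\<in>E. inverse (s x) \<partial>M) = ennreal v * emeasure M E"
    using harmonic_mean_Jensen[OF E s'(1) s1] by metis
  obtain w where w: "0 < w" "w < 1" "harmonic_mean M (conj_exponent s) E = ennreal (1 / w)"
      "(\<integral>\<^sup>+x\<in>E. inverse (conj_exponent s x) \<partial>M) = ennreal w * emeasure M E"
    using harmonic_mean_Jensen[OF E s'(2) s1'] by metis
  have "ennreal v * emeasure M E + ennreal w * emeasure M E
      = (\<integral>\<^sup>+x\<in>E. (inverse (s x) + inverse (conj_exponent s x)) \<partial>M)"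
    unfolding v(4)[symmetric] w(4)[symmetric] by (simp add: nn_integral_add distrib_right)
  also have "\<dots> = (\<integral>\<^sup>+x\<in>E. 1 \<partial>M)"
    using s by (intro nn_integral_cong) (auto simp: var_exponents_def conj_exponent)
  also have "\<dots> = emeasure M E"
    by simp
  finally have "ennreal (v + w) * emeasure M E = ennreal 1 * emeasure M E"
    using v w by (simp add: distrib_right)
  then have "ennreal (v + w) = ennreal 1"
    using E by (metis mult_divide_eq_ennreal less_irrefl infinity_ennreal_def)
  then have "w = 1 - v"
    using v w by (simp add: ennreal_inj del: ennreal_1 ennreal_plus)
  with v w show thesis
    by (intro that[of v]) (auto simp: inverse_ennreal)
qed

lemma conj_exponent_harmonic_mean:
  assumes "E i \<in> sets M" "0 < emeasure M (E i)" "emeasure M (E i) < \<infinity>"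
    and "s \<in> var_exponents M"
    and "AE x in M. 1 < s x \<and> s x < \<infinity>"
  shows "conj_exponent (\<lambda>i. harmonic_mean M s (E i)) i = harmonic_mean M (conj_exponent s) (E i)"
proof -
  obtain v where v: "0 < v" "v < 1" "inverse (harmonic_mean M s (E i)) = ennreal v"
    "inverse (harmonic_mean M (conj_exponent s) (E i)) = ennreal (1 - v)"
    using harmonic_mean_conj_exponent[OF assms] .
  have "1 - inverse (harmonic_mean M s (E i)) = inverse (harmonic_mean M (conj_exponent s) (E i))"
    using v by (simp add: ennreal_minus flip: ennreal_1)
  then show ?thesis
    by (simp add: conj_exponent_def[of "\<lambda>i. harmonic_mean M s (E i)"])
qed

section \<open>Sequences indexed by disjoint sets\<close>

lemma emeasure_eq_measure_pos:
  assumes "0 < emeasure M A" "emeasure M A < \<infinity>"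
  shows "0 < measure M A" "emeasure M A = ennreal (measure M A)"
proof -
  show *: "emeasure M A = ennreal (measure M A)"
    using assms by (intro emeasure_eq_ennreal_measure) auto
  show "0 < measure M A"
    using assms(1) unfolding * by simp
qed

lemma nn_integral_disjoint_UN:
  assumes "countable I" "\<And>i. i \<in> I \<Longrightarrow> A i \<in> sets M" "disjoint_family_on A I"
    and f: "f \<in> borel_measurable M"
  shows "(\<integral>\<^sup>+x\<in>(\<Union>i\<in>I. A i). f x \<partial>M) = (\<integral>\<^sup>+i. (\<integral>\<^sup>+x\<in>A i. f x \<partial>M) \<partial>count_space I)"
proof -
  have "(\<integral>\<^sup>+x\<in>(\<Union>i\<in>I. A i). f x \<partial>M) = emeasure (density M f) (\<Union>i\<in>I. A i)"
    using assms by (subst emeasure_density) auto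
  also have "\<dots> = (\<integral>\<^sup>+i. emeasure (density M f) (A i) \<partial>count_space I)"
    using assms by (intro emeasure_UN_countable) auto
  also have "\<dots> = (\<integral>\<^sup>+i. (\<integral>\<^sup>+x\<in>A i. f x \<partial>M) \<partial>count_space I)"
    using assms by (intro nn_integral_cong) (simp add: emeasure_density)
  finally show ?thesis .
qed

text \<open>
  The function \<open>F\<close> only has to dominate the sequence on the sets \<open>E i\<close>: besides the step function with the
  values \<open>\<alpha> i\<close> this covers maximal functions, which dominate averages.
\<close>

lemma var_norm_harmonic_means_le:
  assumes I: "countable I"
    and E: "\<And>i. i \<in> I \<Longrightarrow> E i \<in> sets M \<and> 0 < emeasure M (E i) \<and> emeasure M (E i) < \<infinity>"
    and disj: "disjoint_family_on E I"
    and s [measurable]: "s \<in> borel_measurable M"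
    and s1: "AE x in M. 1 < s x \<and> s x < \<infinity>"
    and F [measurable]: "F \<in> borel_measurable M"
    and le: "\<And>i x. i \<in> I \<Longrightarrow> x \<in> E i \<Longrightarrow> \<alpha> i \<le> F x"
  defines "t \<equiv> \<lambda>i. harmonic_mean M s (E i)"
  shows "var_norm (count_space I) t (\<lambda>i. \<alpha> i * ennreal (measure M (E i) powr enn2real (inverse (t i))))
    \<le> ennreal 8 * var_norm M s F"
proof (rule var_norm_le_cmult)
  fix l :: real
  assume l: "0 < l" "var_modular M s (\<lambda>x. F x / ennreal l) \<le> 1"
  let ?\<Phi> = "\<lambda>x. enn_power (F x / ennreal l) (enn2real (s x))"
  have s_fin: "AE x in M. s x < \<infinity>"
    using s1 by auto
  have t: "1 < t i" "t i < \<infinity>" if "i \<in> I" for i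
    using harmonic_mean_bounds[of "E i" M s] E[OF that] s s1 by (auto simp: t_def)
  have "var_modular (count_space I) t
      (\<lambda>i. \<alpha> i * ennreal (measure M (E i) powr enn2real (inverse (t i))) / ennreal (8 * l))
    = (\<integral>\<^sup>+i. enn_power (\<alpha> i * ennreal (measure M (E i) powr enn2real (inverse (t i))) / ennreal (8 * l))
          (enn2real (t i)) \<partial>count_space I)"
    using t by (intro var_modular_eq_nn_integral) (auto simp: AE_count_space)
  also have "\<dots> \<le> (\<integral>\<^sup>+i. (\<integral>\<^sup>+x\<in>E i. ?\<Phi> x \<partial>M) \<partial>count_space I)"
  proof (intro nn_integral_mono)
    fix i
    assume "i \<in> space (count_space I)"
    then have i: "i \<in> I" by simp
    obtain r where r: "t i = ennreal r" "1 < r"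
      using t[OF i] by (cases "t i") (auto simp: ennreal_less_iff simp flip: ennreal_1)
    have m: "0 < measure M (E i)" "emeasure M (E i) = ennreal (measure M (E i))"
      using E[OF i] by (auto intro: emeasure_eq_measure_pos)
    define w where "w = measure M (E i) powr enn2real (inverse (t i))"
    have w: "0 < w" "w powr r = measure M (E i)"
      using r m by (auto simp: w_def inverse_ennreal powr_powr)
    have "\<alpha> i * ennreal w / ennreal (8 * l) = ennreal w * ((\<alpha> i / ennreal l) / 8)"
      using l by (simp add: divide_ennreal_def ennreal_inverse_mult ennreal_mult ac_simps)
    then have "enn_power (\<alpha> i * ennreal w / ennreal (8 * l)) (enn2real (t i))
        = enn_power ((\<alpha> i / ennreal l) / 8) (enn2real (t i)) * emeasure M (E i)"
      using r w m by (simp add: enn_power_mult mult.commute)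
    also have "\<dots> \<le> (\<integral>\<^sup>+x\<in>E i. enn_power (\<alpha> i / ennreal l) (enn2real (s x)) \<partial>M)"
      unfolding t_def using E[OF i] s s1 by (intro enn_power_harmonic_mean_le) auto
    also have "\<dots> \<le> (\<integral>\<^sup>+x\<in>E i. ?\<Phi> x \<partial>M)"
      using le[OF i]
      by (intro nn_integral_mono)
         (auto simp: indicator_def intro!: enn_power_mono divide_right_mono_ennreal)
    finally show "enn_power (\<alpha> i * ennreal (measure M (E i) powr enn2real (inverse (t i))) / ennreal (8 * l))
          (enn2real (t i)) \<le> (\<integral>\<^sup>+x\<in>E i. ?\<Phi> x \<partial>M)"
      by (simp add: w_def)
  qed
  also have "\<dots> = (\<integral>\<^sup>+x\<in>(\<Union>i\<in>I. E i). ?\<Phi> x \<partial>M)"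
    using I E disj by (intro nn_integral_disjoint_UN[symmetric]) auto
  also have "\<dots> \<le> (\<integral>\<^sup>+x. ?\<Phi> x \<partial>M)"
    by (intro nn_integral_mono) (auto simp: indicator_def)
  also have "\<dots> = var_modular M s (\<lambda>x. F x / ennreal l)"
    using s_fin by (simp add: var_modular_eq_nn_integral)
  also have "\<dots> \<le> 1"
    by (fact l(2))
  finally show "var_modular (count_space I) t
      (\<lambda>i. \<alpha> i * ennreal (measure M (E i) powr enn2real (inverse (t i))) / ennreal (8 * l)) \<le> 1" .
qed simp

section \<open>Duality\<close>

text \<open>
  Equality in Hoelder's inequality suggests \<open>g = (f/\<kappa>)\<^bsup>s-1\<^esup>\<close>, for which both the modular of \<open>g\<close> and
  \<open>\<integral> (f/\<kappa>) g\<close> are the integral of \<open>\<phi> = (f/\<kappa>)\<^sup>s\<close>. By the choice of \<open>\<kappa>\<close> this integral exceeds \<open>1\<close>, but it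
  can be infinite; so \<open>g\<close> is restricted to a set \<open>A\<close> on which the integral is a finite number \<open>R > 1\<close>.
  Such a set exists because \<open>\<phi>\<close> is finite, so that the measure with density \<open>\<phi>\<close> is \<open>\<sigma>\<close>-finite. Dividing \<open>g\<close>
  by \<open>R\<close> brings the modular down to at most \<open>1\<close>, because \<open>R\<^bsup>-s'\<^esup> \<le> R\<^bsup>-1\<^esup>\<close>, and the pairing with
  \<open>f\<close> to exactly \<open>\<kappa>\<close>.
\<close>

lemma (in sigma_finite_measure) var_norm_dual_witness:
  assumes s [measurable]: "s \<in> borel_measurable M"
    and s1: "AE x in M. 1 < s x \<and> s x < \<infinity>"
    and f [measurable]: "f \<in> borel_measurable M" and f_fin: "\<And>x. f x < \<infinity>"
    and \<kappa>: "0 < \<kappa>" "ennreal \<kappa> < var_norm M s f"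
  obtains g :: "'a \<Rightarrow> real" where "g \<in> borel_measurable M" "\<And>x. 0 \<le> g x"
    "var_norm M (conj_exponent s) (\<lambda>x. ennreal (g x)) \<le> 1"
    "(\<integral>\<^sup>+x. f x * ennreal (g x) \<partial>M) = ennreal \<kappa>"
proof -
  define b where "b x = enn2real (f x) / \<kappa>" for x
  define r where "r x = enn2real (s x)" for x
  have [measurable]: "b \<in> borel_measurable M" "r \<in> borel_measurable M"
    unfolding b_def r_def by measurable
  have b: "0 \<le> b x" "f x = ennreal (\<kappa> * b x)" for x
    using f_fin[of x] \<kappa> by (auto simp: b_def less_top)
  define \<phi> where "\<phi> x = ennreal (b x powr r x)" for x
  have [measurable]: "\<phi> \<in> borel_measurable M"
    unfolding \<phi>_def by measurable
  define D where "D = density M \<phi>"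
  have "var_modular M s (\<lambda>x. f x / ennreal \<kappa>) = (\<integral>\<^sup>+x. enn_power (f x / ennreal \<kappa>) (enn2real (s x)) \<partial>M)"
    using s1 by (intro var_modular_eq_nn_integral) auto
  also have "\<dots> = (\<integral>\<^sup>+x. \<phi> x \<partial>M)"
    using b \<kappa> by (intro nn_integral_cong) (simp add: \<phi>_def r_def divide_ennreal enn_power_ennreal)
  also have "\<dots> = emeasure D (space M)"
    unfolding D_def by (simp add: emeasure_density)
  finally have D_space: "1 < emeasure D (space M)"
    using \<kappa> var_norm_le[of \<kappa> M s f] by (auto simp: not_le[symmetric])
  interpret D: sigma_finite_measure D
    unfolding D_def by (subst sigma_finite_iff_density_finite) (auto simp: \<phi>_def)
  obtain A where A: "A \<in> sets M" "1 < emeasure D A" "emeasure D A < \<infinity>"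
  proof (cases "emeasure D (space M) = \<infinity>")
    case True
    obtain Z where "Z \<in> sets D" "emeasure D Z < \<infinity>" "emeasure D Z > ennreal 1"
      using D.approx_PInf_emeasure_with_finite[of "space M" 1] True
      by (metis D_def sets.top sets_density space_density)
    then show thesis
      by (intro that[of Z]) (simp_all add: D_def)
  next
    case False
    with D_space show thesis
      by (intro that[of "space M"]) (auto simp: less_top)
  qed
  note [measurable] = A(1)
  define R where "R = measure D A"
  have R_eq: "emeasure D A = ennreal R"
    using A by (simp add: R_def emeasure_eq_ennreal_measure less_top)
  with A have R: "1 < R"
    by (simp add: R_def ennreal_less_iff flip: ennreal_1)
  define g where "g x = indicator A x * (b x powr (r x - 1) / R)" for x
  have [measurable]: "g \<in> borel_measurable M"
    unfolding g_def by measurable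
  have one: "(\<integral>\<^sup>+x. ennreal (indicator A x * (b x powr r x / R)) \<partial>M) = 1"
  proof -
    have "(\<integral>\<^sup>+x. ennreal (indicator A x * (b x powr r x / R)) \<partial>M)
        = (\<integral>\<^sup>+x. ennreal (1 / R) * (\<phi> x * indicator A x) \<partial>M)"
      using R by (intro nn_integral_cong) (auto simp: \<phi>_def indicator_def simp flip: ennreal_mult)
    also have "\<dots> = ennreal (1 / R) * emeasure D A"
      by (simp add: nn_integral_cmult D_def emeasure_density)
    finally show ?thesis
      using R by (simp add: R_eq flip: ennreal_mult)
  qed
  show thesis
  proof
    show "0 \<le> g x" for x
      using R by (simp add: g_def)
    have "var_modular M (conj_exponent s) (\<lambda>x. ennreal (g x))
      = (\<integral>\<^sup>+x. enn_power (ennreal (g x)) (enn2real (conj_exponent s x)) \<partial>M)"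
    proof (rule var_modular_eq_nn_integral)
      show "conj_exponent s \<in> borel_measurable M"
        unfolding conj_exponent_def[abs_def] by measurable
      show "AE x in M. conj_exponent s x < \<infinity>"
        by (rule eventually_mono[OF s1]) (simp add: one_less_conj_exponent)
    qed measurable
    also have "\<dots> \<le> (\<integral>\<^sup>+x. ennreal (indicator A x * (b x powr r x / R)) \<partial>M)"
    proof (rule nn_integral_mono_AE, rule eventually_mono[OF s1])
      fix x
      assume x: "1 < s x \<and> s x < \<infinity>"
      then obtain \<rho> where \<rho>: "1 < \<rho>" "s x = ennreal \<rho>" "conj_exponent s x = ennreal (\<rho> / (\<rho> - 1))"
        using one_less_conj_exponent_finite[of s x] by metis
      define q where "q = \<rho> / (\<rho> - 1)"
      have q: "1 \<le> q" "(\<rho> - 1) * q = \<rho>"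
        using \<rho> by (auto simp: q_def field_simps)
      have "(b x powr (\<rho> - 1) / R) powr q = b x powr \<rho> / R powr q"
        using R q b[of x] by (simp add: powr_divide powr_powr)
      also have "\<dots> \<le> b x powr \<rho> / R powr 1"
        using R q by (intro divide_left_mono powr_mono) auto
      finally show "enn_power (ennreal (g x)) (enn2real (conj_exponent s x))
          \<le> ennreal (indicator A x * (b x powr r x / R))"
        using R \<rho> q by (auto simp: g_def r_def q_def enn_power_ennreal indicator_def intro!: ennreal_leI)
    qed
    finally have "var_modular M (conj_exponent s) (\<lambda>x. ennreal (g x) / ennreal 1) \<le> 1"
      using one by (simp add: divide_ennreal_def)
    then show "var_norm M (conj_exponent s) (\<lambda>x. ennreal (g x)) \<le> 1"
      using var_norm_le[of 1 M "conj_exponent s" "\<lambda>x. ennreal (g x)"] by simp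
    have "(\<integral>\<^sup>+x. f x * ennreal (g x) \<partial>M)
        = (\<integral>\<^sup>+x. ennreal \<kappa> * ennreal (indicator A x * (b x powr r x / R)) \<partial>M)"
    proof (rule nn_integral_cong)
      fix x
      have "b x * b x powr (r x - 1) = b x powr r x"
        using b[of x] by (simp add: powr_mult_base)
      then have "\<kappa> * b x * g x = \<kappa> * (indicator A x * (b x powr r x / R))"
        by (simp add: g_def mult.assoc mult.left_commute)
      then show "f x * ennreal (g x) = ennreal \<kappa> * ennreal (indicator A x * (b x powr r x / R))"
        unfolding b(2)[of x] using \<kappa> b[of x] R by (simp add: g_def flip: ennreal_mult)
    qed
    also have "\<dots> = ennreal \<kappa>"
      using one by (simp add: nn_integral_cmult)
    finally show "(\<integral>\<^sup>+x. f x * ennreal (g x) \<partial>M) = ennreal \<kappa>" .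
  qed measurable
qed

section \<open>The maximal operator\<close>

lemma maximal_op_measurable:
  assumes "countable \<B>" "\<And>B. B \<in> \<B> \<Longrightarrow> B \<in> sets M"
  shows "maximal_op M \<B> h \<in> borel_measurable M"
  unfolding maximal_op_def using assms by (intro borel_measurable_SUP) auto

text \<open>
  The number \<open>k\<close> below the norm of \<open>f\<close> is written as a pairing \<open>\<integral> f g\<close>, and the integral of \<open>g\<close> over \<open>E B\<close> is
  enlarged to the one over \<open>B\<close>. The factor \<open>\<mu>(E B)\<close> that turns \<open>a B \<mu>(B)/\<mu>(E B)\<close> times an average of \<open>g\<close> into
  \<open>a B\<close> times its integral is split as \<open>\<mu>(E B)\<^bsup>1/t\<^esup> \<mu>(E B)\<^bsup>1/t'\<^esup>\<close> between the two sequences of Hoelder's inequality.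
\<close>

lemma (in sigma_finite_measure) var_norm_le_maximal_op_norm:
  assumes s: "s \<in> var_exponents M"
    and s1: "AE x in M. 1 < s x \<and> s x < \<infinity>"
    and \<B>: "countable \<B>" "\<And>B. B \<in> \<B> \<Longrightarrow> B \<in> sets M \<and> 0 < emeasure M B \<and> emeasure M B < \<infinity>"
    and E: "\<And>B. B \<in> \<B> \<Longrightarrow> E B \<in> sets M \<and> E B \<subseteq> B \<and> 0 < emeasure M (E B) \<and> emeasure M (E B) < \<infinity>"
    and disj: "disjoint_family_on E \<B>"
    and a: "\<And>B. B \<in> \<B> \<Longrightarrow> (0::real) \<le> a B"
    and f [measurable]: "f \<in> borel_measurable M"
    and f_E: "\<And>B x. B \<in> \<B> \<Longrightarrow> x \<in> E B \<Longrightarrow> f x = ennreal (a B)"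
    and f_0: "\<And>x. x \<notin> (\<Union>B\<in>\<B>. E B) \<Longrightarrow> f x = 0"
  defines "t \<equiv> \<lambda>B. harmonic_mean M s (E B)"
  shows "var_norm M s f \<le> ennreal 16 * maximal_op_norm M \<B> (conj_exponent s) *
    var_norm (count_space \<B>) t
      (\<lambda>B. ennreal (measure M B / measure M (E B) * a B * measure M (E B) powr enn2real (inverse (t B))))"
    (is "_ \<le> ennreal 16 * ?N * ?A")
proof (rule dense_le)
  fix k
  assume k: "k < var_norm M s f"
  show "k \<le> ennreal 16 * ?N * ?A"
  proof (cases "k = 0")
    case False
    moreover have "k < top"
      using k by (rule less_le_trans) simp
    ultimately obtain \<kappa> where \<kappa>: "k = ennreal \<kappa>" "0 < \<kappa>"
      by (cases k) (auto simp: less_le)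
    note s_meas [measurable] = s[unfolded var_exponents_def, THEN CollectD, THEN conjunct1]
    have f_fin: "f x < \<infinity>" for x
      by (cases "x \<in> (\<Union>B\<in>\<B>. E B)") (auto simp: f_E f_0)
    obtain g :: "'a \<Rightarrow> real" where g [measurable]: "g \<in> borel_measurable M" and g_nonneg: "\<And>x. 0 \<le> g x"
      and g_norm: "var_norm M (conj_exponent s) (\<lambda>x. ennreal (g x)) \<le> 1"
      and g_pairing: "(\<integral>\<^sup>+x. f x * ennreal (g x) \<partial>M) = k"
      using var_norm_dual_witness[OF s_meas s1 f f_fin \<kappa>(2)] k unfolding \<kappa>(1) by metis
    define s' where "s' = conj_exponent s"
    have s' [measurable]: "s' \<in> borel_measurable M"
      using conj_exponent_in_var_exponents[OF s] by (simp add: s'_def var_exponents_def)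
    have s'1: "AE x in M. 1 < s' x \<and> s' x < \<infinity>"
      by (rule eventually_mono[OF s1]) (simp add: s'_def one_less_conj_exponent)
    define t' where "t' B = harmonic_mean M s' (E B)" for B
    define c where "c B = ennreal (measure M B / measure M (E B) * a B
        * measure M (E B) powr enn2real (inverse (t B)))" for B
    define \<alpha> where "\<alpha> B = 1 / emeasure M B * (\<integral>\<^sup>+y\<in>B. ennreal \<bar>g y\<bar> \<partial>M)" for B
    define d where "d B = \<alpha> B * ennreal (measure M (E B) powr enn2real (inverse (t' B)))" for B
    have t_bounds: "1 < t B" "t B < \<infinity>" if "B \<in> \<B>" for B
      using harmonic_mean_bounds[of "E B" M s] E[OF that] s1 by (auto simp: t_def)
    (* c is the sequence on the right-hand side of the claim, d carries the averages of g. *)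
    have "k = (\<integral>\<^sup>+x\<in>(\<Union>B\<in>\<B>. E B). f x * ennreal (g x) \<partial>M)"
      unfolding g_pairing[symmetric]
      by (intro nn_integral_cong) (auto simp: indicator_def f_0)
    also have "\<dots> = (\<integral>\<^sup>+B. (\<integral>\<^sup>+x\<in>E B. f x * ennreal (g x) \<partial>M) \<partial>count_space \<B>)"
      using \<B> E disj by (intro nn_integral_disjoint_UN) auto
    also have "\<dots> \<le> (\<integral>\<^sup>+B. c B * d B \<partial>count_space \<B>)"
    proof (rule nn_integral_mono)
      fix B
      assume "B \<in> space (count_space \<B>)"
      then have B: "B \<in> \<B>" by simp
      note [measurable] = \<B>(2)[OF B, THEN conjunct1] E[OF B, THEN conjunct1]
      have m: "0 < measure M B" "emeasure M B = ennreal (measure M B)"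
          "0 < measure M (E B)" "emeasure M (E B) = ennreal (measure M (E B))"
        using E[OF B] \<B>(2)[OF B] by (auto intro: emeasure_eq_measure_pos)
      obtain v where v: "0 < v" "v < 1" "inverse (t B) = ennreal v" "inverse (t' B) = ennreal (1 - v)"
        using harmonic_mean_conj_exponent[of "E B" M s] E[OF B] s s1
        unfolding t_def t'_def s'_def by metis
      have "(\<integral>\<^sup>+x\<in>E B. f x * ennreal (g x) \<partial>M) = (\<integral>\<^sup>+x. ennreal (a B) * (ennreal (g x) * indicator (E B) x) \<partial>M)"
        using f_E[OF B] by (intro nn_integral_cong) (auto simp: indicator_def)
      also have "\<dots> = ennreal (a B) * (\<integral>\<^sup>+x\<in>E B. ennreal (g x) \<partial>M)"
        by (rule nn_integral_cmult) measurable
      also have "\<dots> \<le> ennreal (a B) * (\<integral>\<^sup>+x\<in>B. ennreal \<bar>g x\<bar> \<partial>M)"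
        using E[OF B] g_nonneg by (intro mult_left_mono nn_integral_mono) (auto simp: indicator_def)
      also have "ennreal (a B) = c B * (ennreal (1 / measure M B) * ennreal (measure M (E B) powr (1 - v)))"
      proof -
        have "measure M (E B) powr v * measure M (E B) powr (1 - v) = measure M (E B)"
          using m by (simp flip: powr_add)
        then have "a B = measure M B / measure M (E B) * a B * measure M (E B) powr v
            * (1 / measure M B * measure M (E B) powr (1 - v))"
          using m by (simp add: field_simps)
        then show ?thesis
          using m v a[OF B] by (simp add: c_def flip: ennreal_mult)
      qed
      also have "c B * (ennreal (1 / measure M B) * ennreal (measure M (E B) powr (1 - v)))
          * (\<integral>\<^sup>+x\<in>B. ennreal \<bar>g x\<bar> \<partial>M) = c B * d B"
        using m v by (simp add: d_def \<alpha>_def ac_simps divide_ennreal flip: ennreal_1)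
      finally show "(\<integral>\<^sup>+x\<in>E B. f x * ennreal (g x) \<partial>M) \<le> c B * d B" .
    qed
    also have "\<dots> \<le> 2 * (?A * var_norm (count_space \<B>) (conj_exponent t) d)"
      unfolding c_def[abs_def, symmetric]
      using t_bounds by (intro var_Hoelder) (auto simp: AE_count_space)
    also have "var_norm (count_space \<B>) (conj_exponent t) d = var_norm (count_space \<B>) t' d"
    proof -
      have "conj_exponent t B = t' B" if "B \<in> \<B>" for B
        unfolding t_def t'_def s'_def
        using E[OF that] s s1 by (intro conj_exponent_harmonic_mean) auto
      then show ?thesis
        by (intro var_norm_cong_exponent) simp
    qed
    also have "2 * (?A * var_norm (count_space \<B>) t' d) \<le> 2 * (?A * (8 * var_norm M s' (maximal_op M \<B> g)))"
    proof -
      have "var_norm (count_space \<B>) t' d \<le> ennreal 8 * var_norm M s' (maximal_op M \<B> g)"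
        unfolding d_def[abs_def] t'_def
      proof (rule var_norm_harmonic_means_le)
        show "\<alpha> B \<le> maximal_op M \<B> g x" if "B \<in> \<B>" "x \<in> E B" for B x
          unfolding maximal_op_def \<alpha>_def
          using that E[of B] by (intro SUP_upper2[of B]) (auto simp: indicator_def)
      qed (use \<B> E disj s' s'1 in \<open>auto intro: maximal_op_measurable\<close>)
      then show ?thesis
        by (intro mult_left_mono) auto
    qed
    finally have k_le: "k \<le> ennreal 16 * var_norm M s' (maximal_op M \<B> g) * ?A"
      by (simp add: ac_simps)
    (* An infinite operator norm times a vanishing sequence norm is 0; then k_le itself gives k = 0. *)
    show ?thesis
    proof (cases "?N < \<infinity>")
      case True
      have "g \<in> var_Lebesgue M s'"
        using g_nonneg le_less_trans[OF g_norm, of \<infinity>] by (simp add: var_Lebesgue_def s'_def)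
      with True have "var_norm M s' (maximal_op M \<B> g) \<le> ?N * var_norm M s' (\<lambda>x. ennreal \<bar>g x\<bar>)"
        unfolding s'_def by (rule maximal_op_norm_bound)
      also have "\<dots> \<le> ?N * 1"
        using g_nonneg g_norm by (intro mult_left_mono) (auto simp: s'_def)
      finally have "ennreal 16 * var_norm M s' (maximal_op M \<B> g) * ?A \<le> ennreal 16 * ?N * ?A"
        by (intro mult_right_mono mult_left_mono) auto
      with k_le show ?thesis
        by (rule order_trans)
    next
      case False
      with k_le show ?thesis
        by (cases "?A = 0") (auto simp: not_less top_unique ennreal_mult_top ennreal_top_mult_right)
    qed
  qed simp
qed

theorem proposition2p7:
  shows "\<exists>C::real. 0 < C \<and> C \<le> 100 \<and>
    (\<forall>(M :: 'a measure) s \<B> E a.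
       sigma_finite_measure M \<and>
       s \<in> var_exponents M \<and>
       (AE x in M. 1 < s x \<and> s x < \<infinity>) \<and>
       countable \<B> \<and>
       (\<forall>B\<in>\<B>. B \<in> sets M \<and> 0 < emeasure M B \<and> emeasure M B < \<infinity>) \<and>
       (\<forall>B\<in>\<B>. E B \<in> sets M \<and> E B \<subseteq> B \<and> 0 < emeasure M (E B) \<and> emeasure M (E B) < \<infinity>) \<and>
       disjoint_family_on E \<B> \<and>
       (\<forall>B\<in>\<B>. (0::real) \<le> a B)
       \<longrightarrow>
       (let t = (\<lambda>B. harmonic_mean M s (E B));
            f = (\<lambda>x. \<Sum>\<^sub>\<infinity>B\<in>\<B>. a B * indicator (E B) x)
        in
          var_norm (count_space \<B>) t
              (\<lambda>B. ennreal (a B * measure M (E B) powr enn2real (inverse (t B))))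
            \<le> ennreal C * var_norm M s (\<lambda>x. ennreal (f x))
          \<and>
          var_norm M s (\<lambda>x. ennreal (f x))
            \<le> ennreal C * maximal_op_norm M \<B> (conj_exponent s) *
              var_norm (count_space \<B>) t
                (\<lambda>B. ennreal (measure M B / measure M (E B) * a B
                              * measure M (E B) powr enn2real (inverse (t B))))))"
proof (intro exI[of _ 16] conjI allI impI)
  fix M :: "'a measure" and s \<B> E a
  assume "sigma_finite_measure M \<and>
       s \<in> var_exponents M \<and>
       (AE x in M. 1 < s x \<and> s x < \<infinity>) \<and>
       countable \<B> \<and>
       (\<forall>B\<in>\<B>. B \<in> sets M \<and> 0 < emeasure M B \<and> emeasure M B < \<infinity>) \<and>
       (\<forall>B\<in>\<B>. E B \<in> sets M \<and> E B \<subseteq> B \<and> 0 < emeasure M (E B) \<and> emeasure M (E B) < \<infinity>) \<and>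
       disjoint_family_on E \<B> \<and>
       (\<forall>B\<in>\<B>. (0::real) \<le> a B)"
  then have sf: "sigma_finite_measure M"
    and s: "s \<in> var_exponents M" "AE x in M. 1 < s x \<and> s x < \<infinity>"
    and \<B>: "countable \<B>" "\<And>B. B \<in> \<B> \<Longrightarrow> B \<in> sets M \<and> 0 < emeasure M B \<and> emeasure M B < \<infinity>"
    and E: "\<And>B. B \<in> \<B> \<Longrightarrow> E B \<in> sets M \<and> E B \<subseteq> B \<and> 0 < emeasure M (E B) \<and> emeasure M (E B) < \<infinity>"
    and disj: "disjoint_family_on E \<B>"
    and a: "\<And>B. B \<in> \<B> \<Longrightarrow> 0 \<le> a B"
    by auto
  interpret sigma_finite_measure M by (fact sf)
  define t where "t = (\<lambda>B. harmonic_mean M s (E B))"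
  define f where "f x = (\<Sum>\<^sub>\<infinity>B\<in>\<B>. a B * indicator (E B) x)" for x
  have f_E: "f x = a B" if "B \<in> \<B>" "x \<in> E B" for B x
  proof -
    have "x \<notin> E B'" if "B' \<in> \<B>" "B' \<noteq> B" for B'
      using disj that \<open>B \<in> \<B>\<close> \<open>x \<in> E B\<close> by (auto simp: disjoint_family_on_def)
    then have "f x = (\<Sum>\<^sub>\<infinity>B\<in>{B}. a B * indicator (E B) x)"
      unfolding f_def using that by (intro infsum_cong_neutral) auto
    with that show ?thesis
      by simp
  qed
  have f_0: "f x = 0" if "x \<notin> (\<Union>B\<in>\<B>. E B)" for x
    unfolding f_def using that by (intro infsum_0) auto
  (* The supremum describes the same function and makes its measurability evident. *)
  have f_SUP: "ennreal (f x) = (SUP B\<in>\<B>. ennreal (a B) * indicator (E B) x)" for x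
  proof (cases "x \<in> (\<Union>B\<in>\<B>. E B)")
    case True
    then obtain B where B: "B \<in> \<B>" "x \<in> E B" by auto
    show ?thesis
    proof (rule antisym)
      show "ennreal (f x) \<le> (SUP B\<in>\<B>. ennreal (a B) * indicator (E B) x)"
        using B by (intro SUP_upper2[of B]) (auto simp: f_E)
      show "(SUP B\<in>\<B>. ennreal (a B) * indicator (E B) x) \<le> ennreal (f x)"
        by (intro SUP_least) (auto simp: f_E indicator_def)
    qed
  next
    case False
    then have "(SUP B\<in>\<B>. ennreal (a B) * indicator (E B) x) \<le> 0"
      by (intro SUP_least) auto
    with False show ?thesis
      by (simp add: f_0)
  qed
  have f_meas: "(\<lambda>x. ennreal (f x)) \<in> borel_measurable M"
    unfolding f_SUP using \<B>(1) E
    by (intro borel_measurable_SUP borel_measurable_times_ennreal borel_measurable_indicator) auto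
  have "var_norm (count_space \<B>) t (\<lambda>B. ennreal (a B) * ennreal (measure M (E B) powr enn2real (inverse (t B))))
      \<le> ennreal 8 * var_norm M s (\<lambda>x. ennreal (f x))"
    unfolding t_def using \<B>(1) E disj s f_meas f_E
    by (intro var_norm_harmonic_means_le) (auto simp: var_exponents_def)
  also have "\<dots> \<le> ennreal 16 * var_norm M s (\<lambda>x. ennreal (f x))"
    by (intro mult_right_mono) auto
  also have "var_norm (count_space \<B>) t (\<lambda>B. ennreal (a B) * ennreal (measure M (E B) powr enn2real (inverse (t B))))
      = var_norm (count_space \<B>) t (\<lambda>B. ennreal (a B * measure M (E B) powr enn2real (inverse (t B))))"
    by (simp add: ennreal_mult'')
  finally have part1: "var_norm (count_space \<B>) t (\<lambda>B. ennreal (a B * measure M (E B) powr enn2real (inverse (t B))))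
      \<le> ennreal 16 * var_norm M s (\<lambda>x. ennreal (f x))" .
  have part2: "var_norm M s (\<lambda>x. ennreal (f x))
      \<le> ennreal 16 * maximal_op_norm M \<B> (conj_exponent s) * var_norm (count_space \<B>) t
          (\<lambda>B. ennreal (measure M B / measure M (E B) * a B * measure M (E B) powr enn2real (inverse (t B))))"
    unfolding t_def by (rule var_norm_le_maximal_op_norm[OF s \<B> E disj a f_meas]) (auto simp: f_E f_0)
  show "let t = (\<lambda>B. harmonic_mean M s (E B));
            f = (\<lambda>x. \<Sum>\<^sub>\<infinity>B\<in>\<B>. a B * indicator (E B) x)
        in
          var_norm (count_space \<B>) t
              (\<lambda>B. ennreal (a B * measure M (E B) powr enn2real (inverse (t B))))
            \<le> ennreal 16 * var_norm M s (\<lambda>x. ennreal (f x))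
          \<and>
          var_norm M s (\<lambda>x. ennreal (f x))
            \<le> ennreal 16 * maximal_op_norm M \<B> (conj_exponent s) *
              var_norm (count_space \<B>) t
                (\<lambda>B. ennreal (measure M B / measure M (E B) * a B
                              * measure M (E B) powr enn2real (inverse (t B))))"
    using part1 part2 unfolding t_def f_def Let_def by blast
qed simp_all

end
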